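(* For every integer $n\ge 1$, the statistic $\mathrm{DIS}$ is Mahonian on the symmetric group $S_n$, that is, $$\sum_{\pi\in S_n} q^{\mathrm{DIS}(\pi)}=\prod_{i=1}^n \frac{1-q^i}{1-q}.$$
   Context: Let $[n]=\{1,\dots,n\}$ and let $S_n$ be the set of permutations of $[n]$, written as words $\pi(1)\pi(2)\cdots\pi(n)$. Given a sequence $(j_1,\dots,j_n)$ of integers with $1\le j_i\le i$ for all $i$, start with the identity word $12\cdots n$ and, for $i=n,n-1,\dots,1$ in this order, swap the entry currently in position $j_i$ with the entry currently in position $i$ (doing nothing if $j_i=i$). The resulting word is a permutation $\pi\in S_n$. This construction is a bijection between the set of such sequences and $S_n$, so every $\pi\in S_n$ determines a unique sequence $(j_1,\dots,j_n)$ that produces it. For example, $25413\in S_5$ is produced by $j_5=3$, $j_4=j_3=j_2=j_1=1$. Put $d_i=i-j_i$ and define $\mathrm{DIS}(\pi)=\sum_{i=1}^n d_i=\sum_{i=1}^n (i-j_i)$ (the total distance moved rightward by all elements during the procedure). Here $\frac{1-q^i}{1-q}$ denotes the polynomial $1+q+\cdots+q^{i-1}$. *)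

theory Defs
  imports "HOL-Combinatorics.Permutations" "HOL-Library.FuncSet"
    "HOL-Computational_Algebra.Polynomial"
begin

text \<open>A permutation \<open>\<pi>\<close> of \<open>{1..n}\<close> (extended by the identity outside, as in \<^const>\<open>permutes\<close>)
  is read as the word \<open>\<pi> 1, \<pi> 2, \<dots>, \<pi> n\<close>, so exchanging the entries in positions
  \<open>a\<close> and \<open>b\<close> is composition with a transposition \<^emph>\<open>on the right\<close>.\<close>

definition swap_positions :: "nat \<Rightarrow> nat \<Rightarrow> (nat \<Rightarrow> nat) \<Rightarrow> (nat \<Rightarrow> nat)" where
  "swap_positions a b w = w \<circ> transpose a b"

text \<open>\<open>run_swaps j n w\<close> performs the swaps for \<open>i = n, n - 1, \<dots>, 1\<close>, in this order, starting from \<open>w\<close>.\<close>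

primrec run_swaps :: "(nat \<Rightarrow> nat) \<Rightarrow> nat \<Rightarrow> (nat \<Rightarrow> nat) \<Rightarrow> (nat \<Rightarrow> nat)" where
  "run_swaps j 0 w = w"
| "run_swaps j (Suc i) w = run_swaps j i (swap_positions (j (Suc i)) (Suc i) w)"

definition swap_seqs :: "nat \<Rightarrow> (nat \<Rightarrow> nat) set" where
  "swap_seqs n = (\<Pi>\<^sub>E i\<in>{1..n}. {1..i})"

text \<open>The use of \<open>THE\<close> is justified by \<open>bij_betw_run_swaps\<close> below.\<close>

definition swap_seq_of :: "nat \<Rightarrow> (nat \<Rightarrow> nat) \<Rightarrow> (nat \<Rightarrow> nat)" where
  "swap_seq_of n \<pi> = (THE j. j \<in> swap_seqs n \<and> run_swaps j n id = \<pi>)"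

text \<open>The subtraction on \<^typ>\<open>nat\<close> does not truncate, since \<open>j i \<le> i\<close> for \<open>j \<in> swap_seqs n\<close>.\<close>

definition DIS :: "nat \<Rightarrow> (nat \<Rightarrow> nat) \<Rightarrow> nat" where
  "DIS n \<pi> = (\<Sum>i=1..n. i - swap_seq_of n \<pi> i)"

lemma run_swaps_comp: "run_swaps j n w = w \<circ> run_swaps j n id"
proof (induction n arbitrary: w)
  case (Suc n)
  show ?case
    using Suc[of "swap_positions (j (Suc n)) (Suc n) w"]
      Suc[of "swap_positions (j (Suc n)) (Suc n) id"]
    by (simp only: run_swaps.simps swap_positions_def id_comp comp_assoc)
qed simp

lemma run_swaps_Suc:
  "run_swaps j (Suc n) id = transpose (j (Suc n)) (Suc n) \<circ> run_swaps j n id"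
  using run_swaps_comp[of j n "swap_positions (j (Suc n)) (Suc n) id"]
  by (simp add: swap_positions_def)

lemma run_swaps_permutes:
  assumes "\<And>i. i \<in> {1..n} \<Longrightarrow> j i \<in> {1..i}"
  shows "run_swaps j n id permutes {1..n}"
  using assms
proof (induction n)
  case (Suc n)
  have "run_swaps j n id permutes {1..n}"
    using Suc.prems by (intro Suc.IH) auto
  then have "run_swaps j n id permutes {1..Suc n}"
    by (rule permutes_subset) auto
  moreover have "transpose (j (Suc n)) (Suc n) permutes {1..Suc n}"
    using Suc.prems[of "Suc n"] by (intro permutes_swap_id) auto
  ultimately show ?case
    unfolding run_swaps_Suc by (rule permutes_compose)
qed (simp add: permutes_id)

lemma run_swaps_inj:
  assumes "\<And>i. i \<in> {1..n} \<Longrightarrow> j i \<in> {1..i}" "\<And>i. i \<in> {1..n} \<Longrightarrow> j' i \<in> {1..i}"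
    and "run_swaps j n id = run_swaps j' n id" "i \<in> {1..n}"
  shows "j i = j' i"
  using assms
proof (induction n arbitrary: i)
  case (Suc n)
  have p: "run_swaps j n id permutes {1..n}" "run_swaps j' n id permutes {1..n}"
    by (rule run_swaps_permutes, rule Suc.prems, simp)+
  have eq: "transpose (j (Suc n)) (Suc n) \<circ> run_swaps j n id =
      transpose (j' (Suc n)) (Suc n) \<circ> run_swaps j' n id"
    using Suc.prems(3) unfolding run_swaps_Suc .
  have "run_swaps j n id (Suc n) = Suc n" "run_swaps j' n id (Suc n) = Suc n"
    using p by (auto simp: permutes_not_in)
  then have last: "j (Suc n) = j' (Suc n)"
    using fun_cong[OF eq, of "Suc n"] by simp
  have prefix: "run_swaps j n id = run_swaps j' n id"
  proof
    fix x
    show "run_swaps j n id x = run_swaps j' n id x"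
      using fun_cong[OF eq, of x] last by (metis comp_apply transpose_involutory)
  qed
  show ?case
  proof (cases "i = Suc n")
    case False
    then have "i \<in> {1..n}"
      using Suc.prems(4) by auto
    then show ?thesis
      by (intro Suc.IH prefix) (rule Suc.prems, simp | assumption)+
  qed (simp add: last)
qed simp

lemma bij_betw_run_swaps:
  "bij_betw (\<lambda>j. run_swaps j n id) (swap_seqs n) {\<pi>. \<pi> permutes {1..n}}"
proof -
  have inj: "inj_on (\<lambda>j. run_swaps j n id) (swap_seqs n)"
  proof (rule inj_onI)
    fix j j' assume *: "j \<in> swap_seqs n" "j' \<in> swap_seqs n"
      "run_swaps j n id = run_swaps j' n id"
    have "j i = j' i" if "i \<in> {1..n}" for i
      using * that by (intro run_swaps_inj[of n j j']) (auto simp: swap_seqs_def PiE_iff)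
    then show "j = j'"
      using *(1,2) unfolding swap_seqs_def by (intro PiE_ext)
  qed
  have sub: "(\<lambda>j. run_swaps j n id) ` swap_seqs n \<subseteq> {\<pi>. \<pi> permutes {1..n}}"
    by (auto simp: swap_seqs_def PiE_iff simp del: One_nat_def intro!: run_swaps_permutes)
  have "card (swap_seqs n) = card {\<pi>. \<pi> permutes {1..n}}"
    by (simp add: swap_seqs_def card_PiE card_permutations[OF refl] fact_prod)
  then have "(\<lambda>j. run_swaps j n id) ` swap_seqs n = {\<pi>. \<pi> permutes {1..n}}"
    using sub inj by (intro card_subset_eq) (auto simp: card_image finite_permutations)
  then show ?thesis
    using inj by (simp add: bij_betw_def)
qed

end

theory Submission
  imports Defs
begin

text \<open>Since \<open>\<pi> \<mapsto> (j\<^sub>1, \<dots>, j\<^sub>n)\<close> is a bijection, the generating function of \<open>DIS\<close> may be summed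
  over swap sequences instead of permutations. The entries of a swap sequence are chosen
  independently, and the statistic is additive in them, so the sum factorises: the \<open>i\<close>-th factor is
  \<open>\<Sum>j=1..i. q ^ (i - j)\<close>, in which the distance \<open>i - j\<close> takes each value below \<open>i\<close> once.\<close>

text \<open>Injectivity of the swapping procedure makes the definite description denote the sequence that
  one started from.\<close>

lemma swap_seq_of_run_swaps:
  assumes "j \<in> swap_seqs n"
  shows "swap_seq_of n (run_swaps j n id) = j"
  unfolding swap_seq_of_def
  using assms bij_betw_imp_inj_on[OF bij_betw_run_swaps]
  by (intro the_equality) (auto dest: inj_onD)

lemma sum_power_distance:
  fixes q :: "'a::comm_semiring_1"
  shows "(\<Sum>j\<in>{1..i}. q ^ (i - j)) = (\<Sum>k<i. q ^ k)"
  by (rule sum.reindex_bij_witness[where i = "\<lambda>k. i - k" and j = "\<lambda>j. i - j"]) auto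

theorem mainTheorem1:
  fixes n :: nat
  assumes "n \<ge> 1"
  shows "(\<Sum>\<pi> | \<pi> permutes {1..n}. monom 1 1 ^ DIS n \<pi>) =
    (\<Prod>i=1..n. \<Sum>k<i. (monom 1 1 :: int poly) ^ k)"
proof -
  define q :: "int poly" where "q = monom 1 1"
  have "(\<Sum>\<pi> | \<pi> permutes {1..n}. q ^ DIS n \<pi>) =
      (\<Sum>j\<in>swap_seqs n. q ^ DIS n (run_swaps j n id))"
    by (rule sum.reindex_bij_betw[OF bij_betw_run_swaps, symmetric])
  also have "\<dots> = (\<Sum>j\<in>swap_seqs n. \<Prod>i=1..n. q ^ (i - j i))"
    by (intro sum.cong refl) (simp add: DIS_def swap_seq_of_run_swaps power_sum)
  also have "\<dots> = (\<Prod>i=1..n. \<Sum>j\<in>{1..i}. q ^ (i - j))"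
    unfolding swap_seqs_def by (rule prod_sum_PiE[symmetric]) auto
  also have "\<dots> = (\<Prod>i=1..n. \<Sum>k<i. q ^ k)"
    by (simp only: sum_power_distance)
  finally show ?thesis
    unfolding q_def .
qed

end
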